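(* Let $n,N\in\mathbb N$, $m=\frac{n(n+1)}2$, $p\ge1$, $\theta>0$, let $\|\cdot\|=\|\cdot\|_\infty$ be the maximum norm on $\mathbb R^m$ (with $\mathcal S^n$ identified with $\mathbb R^m$ via $\operatorname{svec}$), let $\widehat{\mathsf Q}_1,\dots,\widehat{\mathsf Q}_N\in\mathcal S^n$, let $\widehat{\mathbb P}_N=\frac1N\sum_{i=1}^N\delta_{\widehat{\mathsf Q}_i}$ be the empirical measure and $\overline{\mathsf Q}=\frac1N\sum_{i=1}^N\widehat{\mathsf Q}_i$. Then, independently of $p$, $$\inf_{\mathbf x\in\Delta}\ \sup_{\mathbb P\in\mathbb B_{\theta,p}(\widehat{\mathbb P}_N)}\mathbb E_{\mathbb P}[\mathbf x^\top\widetilde{\mathsf Q}\mathbf x]=\frac\theta{\sqrt2}+\min_{\mathbf x\in\Delta}\ \mathbf x^\top\left(\overline{\mathsf Q}+\frac{\theta(\sqrt2-1)}{\sqrt2}\,\mathsf I\right)\mathbf x,$$ and for all $\mathbf x\in\Delta$ a worst-case distribution (an element of $\mathbb B_{\theta,p}(\widehat{\mathbb P}_N)$ attaining the inner supremum) is given by the same push-forward $\mathbb P^*=T_{\#}\widehat{\mathbb P}_N$ with $T(\mathsf Z)=\mathsf Z+\frac\theta{\sqrt2}\big[\mathbf e\mathbf e^\top+(\sqrt2-1)\mathsf I\big]$. Therefore the minimax gap is zero: $$\inf_{\mathbf x\in\Delta}\ \sup_{\mathbb P\in\mathbb B_{\theta,p}(\widehat{\mathbb P}_N)}\mathbb E_{\mathbb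 P}[\mathbf x^\top\widetilde{\mathsf Q}\mathbf x]=\sup_{\mathbb P\in\mathbb B_{\theta,p}(\widehat{\mathbb P}_N)}\ \inf_{\mathbf x\in\Delta}\mathbb E_{\mathbb P}[\mathbf x^\top\widetilde{\mathsf Q}\mathbf x].$$
   Context: $\mathcal S^n$: real symmetric $n\times n$ matrices; $\mathsf I$: identity; $\mathbf e\in\mathbb R^n$: all-ones vector; $\Delta=\{\mathbf x\in\mathbb R^n:\mathbf x\ge\mathbf 0,\mathbf e^\top\mathbf x=1\}$. For $\mathsf A=(a_{ij})\in\mathcal S^n$, $\operatorname{svec}(\mathsf A)=(a_{11},\dots,a_{nn},\sqrt2a_{12},\sqrt2a_{13},\dots,\sqrt2a_{n-1,n})^\top\in\mathbb R^m$. The Wasserstein distance used is $W_p(\mathbb P,\mathbb P')=\big(\inf_\pi\int\|\operatorname{svec}(\mathsf Q)-\operatorname{svec}(\mathsf Q')\|_\infty^p\,\mathrm d\pi(\mathsf Q,\mathsf Q')\big)^{1/p}$ over couplings $\pi$ of Borel probability measures $\mathbb P,\mathbb P'$ on $\mathcal S^n$; $\mathbb B_{\theta,p}(\mathbb P')=\{\mathbb P:W_p(\mathbb P,\mathbb P')\le\theta\}$. $\mathbb E_{\mathbb P}$ is expectation when $\widetilde{\mathsf Q}$ has law $\mathbb P$. *)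

theory Defs
  imports "HOL-Probability.Probability"
begin

text \<open>The bracket-free notation for matrix types fixes the sort of the index
  type to \<open>finite\<close>; the synonym also admits a linearly ordered one.\<close>

type_synonym 'n sq_matrix = "((real, 'n) vec, 'n) vec"

definition sym_mats :: "(real^'n^'n) set" where
  "sym_mats = {A. transpose A = A}"

definition ones :: "real^'n" where
  "ones = (\<chi> i. 1)"

definition ones_mat :: "real^'n^'n" where
  "ones_mat = (\<chi> i j. ones $ i * ones $ j)"

definition std_simplex :: "(real^'n) set" where
  "std_simplex = {x. (\<forall>i. 0 \<le> x $ i) \<and> ones \<bullet> x = 1}"

definition quad_form :: "real^'n \<Rightarrow> real^'n^'n \<Rightarrow> real" where
  "quad_form x A = x \<bullet> (A *v x)"

text \<open>The positions on and above the diagonal serve as the coordinates of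
  \<open>\<real>\<^sup>m\<close>, \<open>m = n(n+1)/2\<close>. Listing the diagonal first, as is customary
  for \<open>svec\<close>, would only permute coordinates.\<close>

typedef (overloaded) ('n::linorder) upper_idx = "{(i::'n, j). i \<le> j}"
  by (rule exI[of _ "(undefined, undefined)"]) simp

instance upper_idx :: ("{finite,linorder}") finite
proof
  have "inj (Rep_upper_idx :: 'a upper_idx \<Rightarrow> 'a \<times> 'a)"
    by (simp add: inj_def Rep_upper_idx_inject)
  then show "finite (UNIV :: 'a upper_idx set)"
    by (rule finite_imageD[rotated]) (rule finite)
qed

lemma CARD_upper_idx:
  "CARD('n::{finite,linorder} upper_idx) = CARD('n) * (CARD('n) + 1) div 2"
proof -
  let ?U = "{(i::'n, j). i \<le> j}" and ?L = "{(i::'n, j). j \<le> i}"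
  have 1: "CARD('n upper_idx) = card ?U"
    by (rule type_definition.card[OF type_definition_upper_idx])
  have "?L = prod.swap ` ?U" by (auto simp: image_iff)
  then have 2: "card ?L = card ?U"
    by (simp add: card_image)
  have "?U \<inter> ?L = (\<lambda>i. (i, i)) ` UNIV" by auto
  then have 3: "card (?U \<inter> ?L) = CARD('n)"
    by (simp add: card_image inj_on_def)
  have "?U \<union> ?L = UNIV" by auto
  then have 4: "card (?U \<union> ?L) = CARD('n) * CARD('n)"
    by (metis card_cartesian_product UNIV_Times_UNIV)
  have "card ?U + card ?L = card (?U \<union> ?L) + card (?U \<inter> ?L)"
    by (rule card_Un_Int) auto
  then show ?thesis using 1 2 3 4 by (simp add: algebra_simps)
qed

definition svec :: "'n::{finite,linorder} sq_matrix \<Rightarrow> real^('n upper_idx)" where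
  "svec A = (\<chi> k. case Rep_upper_idx k of (i, j) \<Rightarrow>
     if i = j then A $ i $ i else sqrt 2 * A $ i $ j)"

definition sym_borel :: "(real^'n^'n) measure" where
  "sym_borel = restrict_space borel sym_mats"

definition sym_prob_measures :: "(real^'n^'n) measure set" where
  "sym_prob_measures = {P. sets P = sets sym_borel \<and> prob_space P}"

definition couplings :: "'a measure \<Rightarrow> 'b measure \<Rightarrow> ('a \<times> 'b) measure set" where
  "couplings P P' = {\<pi>. sets \<pi> = sets (P \<Otimes>\<^sub>M P') \<and> prob_space \<pi> \<and>
     distr \<pi> P fst = P \<and> distr \<pi> P' snd = P'}"

definition transport_cost ::
  "real \<Rightarrow> 'n::{finite,linorder} sq_matrix measure \<Rightarrow> 'n sq_matrix measure \<Rightarrow> ennreal" where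
  "transport_cost p P P' = (INF \<pi>\<in>couplings P P'.
     \<integral>\<^sup>+(Q, Q'). ennreal (infnorm (svec Q - svec Q') powr p) \<partial>\<pi>)"

text \<open>The distance is extended-valued, since the measures need not have finite
  \<open>p\<close>-th moments.\<close>

definition wasserstein ::
  "real \<Rightarrow> 'n::{finite,linorder} sq_matrix measure \<Rightarrow> 'n sq_matrix measure \<Rightarrow> ennreal" where
  "wasserstein p P P' =
     (if transport_cost p P P' = \<infinity> then \<infinity>
      else ennreal (enn2real (transport_cost p P P') powr (1 / p)))"

definition wasserstein_ball ::
  "real \<Rightarrow> real \<Rightarrow> 'n::{finite,linorder} sq_matrix measure \<Rightarrow> 'n sq_matrix measure set" where
  "wasserstein_ball \<theta> p P' = {P \<in> sym_prob_measures. wasserstein p P P' \<le> ennreal \<theta>}"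

definition empirical_measure :: "nat \<Rightarrow> (nat \<Rightarrow> real^'n^'n) \<Rightarrow> (real^'n^'n) measure" where
  "empirical_measure N Q = measure_of (space sym_borel) (sets sym_borel)
     (\<lambda>A. ennreal (1 / real N) * (\<Sum>i=1..N. emeasure (return sym_borel (Q i)) A))"

lemma emeasure_empirical_measure:
  fixes Q :: "nat \<Rightarrow> real^'n^'n"
  assumes "A \<in> sets sym_borel"
  shows "emeasure (empirical_measure N Q) A =
     ennreal (1 / real N) * (\<Sum>i=1..N. indicator A (Q i))"
proof -
  let ?f = "\<lambda>A. ennreal (1 / real N) * (\<Sum>i=1..N. emeasure (return sym_borel (Q i)) A)"
  have "countably_additive (sets sym_borel) ?f"
  proof (rule countably_additiveI)
    fix A :: "nat \<Rightarrow> (real^'n^'n) set"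
    assume A: "range A \<subseteq> sets sym_borel" "disjoint_family A"
    have "(\<Sum>k. ?f (A k)) = ennreal (1 / real N) *
        (\<Sum>k. \<Sum>i=1..N. emeasure (return sym_borel (Q i)) (A k))"
      by (rule ennreal_suminf_cmult)
    also have "(\<Sum>k. \<Sum>i=1..N. emeasure (return sym_borel (Q i)) (A k)) =
        (\<Sum>i=1..N. \<Sum>k. emeasure (return sym_borel (Q i)) (A k))"
      by (rule suminf_sum) (rule summableI)
    also have "\<dots> = (\<Sum>i=1..N. emeasure (return sym_borel (Q i)) (\<Union>k. A k))"
      using A by (intro sum.cong refl suminf_emeasure) auto
    finally show "(\<Sum>k. ?f (A k)) = ?f (\<Union>k. A k)" .
  qed
  then have "emeasure (empirical_measure N Q) A = ?f A"
    using assms unfolding empirical_measure_def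
    by (intro emeasure_measure_of_sigma sets.sigma_algebra_axioms)
       (auto simp: positive_def)
  then show ?thesis using assms by simp
qed

text \<open>On a Wasserstein ball around an empirical measure (\<open>p \<ge> 1\<close>) the integrand
  is integrable, so the Bochner integral below is a genuine expectation there.\<close>

definition expected_qf :: "(real^'n^'n) measure \<Rightarrow> real^'n \<Rightarrow> real" where
  "expected_qf P x = (\<integral>Q. quad_form x Q \<partial>P)"

definition shift_map :: "real \<Rightarrow> real^'n^'n \<Rightarrow> real^'n^'n" where
  "shift_map \<theta> Z = Z + (\<theta> / sqrt 2) *\<^sub>R (ones_mat + (sqrt 2 - 1) *\<^sub>R mat 1)"

definition worst_case_measure ::
  "real \<Rightarrow> (real^'n^'n) measure \<Rightarrow> (real^'n^'n) measure" where
  "worst_case_measure \<theta> P = distr P sym_borel (shift_map \<theta>)"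

definition sample_mean :: "nat \<Rightarrow> (nat \<Rightarrow> real^'n^'n) \<Rightarrow> real^'n^'n" where
  "sample_mean N Q = (1 / real N) *\<^sub>R (\<Sum>i=1..N. Q i)"

end

theory Submission
  imports Defs
begin

text \<open>
  In \<open>svec\<close> coordinates the ball of radius \<open>t\<close> in the maximum norm is a box, and a box has a
  largest element: the matrix with diagonal entries \<open>t\<close> and off-diagonal entries \<open>t / sqrt 2\<close>,
  which is \<open>(t / sqrt 2) *\<^sub>R corner_mat\<close>. For \<open>x \<ge> 0\<close> the form \<open>x\<^sup>T A x\<close> is monotone in the
  entries of \<open>A\<close>. Hence one perturbation is the worst one of its size for every \<open>x\<close> in the
  simplex, and it is the shift that defines \<open>shift_map\<close>
  (\<open>quad_form_le_infnorm_svec\<close>).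

  For the upper bound on the inner supremum, any coupling of \<open>P\<close> with the empirical measure
  bounds the difference of the two expectations by the mean distance times a factor that depends
  on \<open>x\<close> alone. The mean distance is at most the \<open>p\<close>-th root of the transport cost, which is how
  the answer becomes independent of \<open>p\<close>. Near-optimal couplings then give the bound with radius
  \<open>\<theta>\<close> (\<open>expected_qf_ball_le\<close>). Translating every atom by the worst perturbation moves
  all mass by exactly \<open>\<theta>\<close>, so it stays in the ball for every \<open>p\<close>
  (\<open>worst_case_measure_in_ball\<close>), and it attains the bound.

  The maximizer does not depend on \<open>x\<close>. This single measure is thus a saddle point: both sides
  of the minimax equality equal the infimum of its expectation over \<open>x\<close>. That infimum
  is the minimum of a quadratic form, up to a constant, because \<open>x\<^sup>T e e\<^sup>T x = 1\<close> on the simplex.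
\<close>

section \<open>Quadratic forms on the simplex\<close>

text \<open>The scaling makes all \<open>svec\<close> coordinates equal to \<open>sqrt 2\<close>.\<close>

definition corner_mat :: "real^'n^'n" where
  "corner_mat = ones_mat + (sqrt 2 - 1) *\<^sub>R mat 1"

lemma corner_mat_nth:
  "corner_mat $ i $ j = (if i = j then sqrt 2 else 1)"
  by (simp add: corner_mat_def ones_mat_def ones_def mat_def)

lemma shift_map_eq: "shift_map \<theta> Z = Z + (\<theta> / sqrt 2) *\<^sub>R corner_mat"
  by (simp add: shift_map_def corner_mat_def)

lemma quad_form_eq_sum: "quad_form x A = (\<Sum>i\<in>UNIV. \<Sum>j\<in>UNIV. x $ i * (A $ i $ j * x $ j))"
  by (simp add: quad_form_def inner_vec_def matrix_vector_mult_def sum_distrib_left)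

lemma quad_form_add: "quad_form x (A + B) = quad_form x A + quad_form x B"
  by (simp add: quad_form_def matrix_vector_mult_add_rdistrib inner_add_right)

lemma quad_form_scaleR: "quad_form x (c *\<^sub>R A) = c * quad_form x A"
  by (simp add: quad_form_def scaleR_matrix_vector_assoc[symmetric])

lemma linear_quad_form: "linear (quad_form x)"
  by (rule linearI) (simp_all add: quad_form_add quad_form_scaleR)

lemma quad_form_mono:
  assumes "\<And>i. 0 \<le> x $ i" and "\<And>i j. A $ i $ j \<le> B $ i $ j"
  shows "quad_form x A \<le> quad_form x B"
  unfolding quad_form_eq_sum
  by (intro sum_mono mult_left_mono mult_right_mono assms)

lemma quad_form_corner_mat:
  assumes "x \<in> std_simplex"
  shows "quad_form x corner_mat = 1 + (sqrt 2 - 1) * quad_form x (mat 1)"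
proof -
  have s: "(\<Sum>i\<in>UNIV. x $ i) = 1"
    using assms by (simp add: std_simplex_def ones_def inner_vec_def)
  have "quad_form x ones_mat = (\<Sum>i\<in>UNIV. x $ i) * (\<Sum>j\<in>UNIV. x $ j)"
    by (simp add: quad_form_eq_sum ones_mat_def ones_def sum_product)
  then show ?thesis
    by (simp add: corner_mat_def quad_form_add quad_form_scaleR s)
qed

lemma quad_form_corner_mat_pos:
  assumes "x \<in> std_simplex"
  shows "0 < quad_form x corner_mat"
proof -
  have "0 \<le> quad_form x (mat 1)" by (simp add: quad_form_def)
  then have "0 \<le> (sqrt 2 - 1) * quad_form x (mat 1)" by simp
  then show ?thesis by (simp add: quad_form_corner_mat[OF assms])
qed

lemma continuous_on_quad_form: "continuous_on S (\<lambda>x. quad_form x A)"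
  unfolding quad_form_eq_sum by (intro continuous_intros)

lemma compact_std_simplex: "compact (std_simplex :: (real^'n) set)"
proof -
  have "closed {x::real^'n. \<forall>i. 0 \<le> x $ i}"
    by (intro closed_Collect_all closed_Collect_le continuous_intros)
  moreover have "closed {x::real^'n. ones \<bullet> x = 1}"
    by (intro closed_Collect_eq continuous_intros)
  ultimately have c: "closed (std_simplex :: (real^'n) set)"
    unfolding std_simplex_def Collect_conj_eq by (rule closed_Int)
  have "bounded (std_simplex :: (real^'n) set)"
  proof (rule boundedI)
    fix x :: "real^'n" assume x: "x \<in> std_simplex"
    then have "norm x \<le> (\<Sum>i\<in>UNIV. \<bar>x $ i\<bar>)" by (intro norm_le_l1_cart)
    also have "\<dots> = 1"
      using x by (simp add: std_simplex_def ones_def inner_vec_def)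
    finally show "norm x \<le> 1" .
  qed
  with c show ?thesis by (simp add: compact_eq_bounded_closed)
qed

lemma std_simplex_nonempty: "(std_simplex :: (real^'n) set) \<noteq> {}"
proof -
  have "axis undefined 1 \<in> (std_simplex :: (real^'n) set)"
    by (simp add: std_simplex_def ones_def inner_axis) (simp add: axis_def)
  then show ?thesis by blast
qed

section \<open>The maximum norm of the vectorization\<close>

lemma svec_nth:
  "svec A $ k = (if fst (Rep_upper_idx k) = snd (Rep_upper_idx k)
      then A $ fst (Rep_upper_idx k) $ snd (Rep_upper_idx k)
      else sqrt 2 * A $ fst (Rep_upper_idx k) $ snd (Rep_upper_idx k))"
  by (simp add: svec_def split: prod.split)

lemma svec_add: "svec (A + B) = svec A + svec B"
  by (simp add: vec_eq_iff svec_nth algebra_simps)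

lemma svec_scaleR: "svec (c *\<^sub>R A) = c *\<^sub>R svec A"
  by (simp add: vec_eq_iff svec_nth)

lemma linear_svec: "linear svec"
  by (rule linearI) (simp_all add: svec_add svec_scaleR)

lemma infnorm_svec_corner_mat:
  "infnorm (svec (corner_mat :: 'n::{finite,linorder} sq_matrix)) = sqrt 2"
proof -
  have "svec (corner_mat :: 'n sq_matrix) $ k = sqrt 2" for k
    by (simp add: svec_nth corner_mat_nth)
  then have "{\<bar>svec (corner_mat :: 'n sq_matrix) $ k\<bar> |k. k \<in> UNIV} = {sqrt 2}"
    by auto
  then show ?thesis by (simp only: infnorm_cart cSup_singleton)
qed

text \<open>Every matrix in the box lies below the largest corner. The function \<open>svec\<close> does not see the
  entries below the diagonal, so symmetry is needed to reduce them to those above it.\<close>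

lemma sym_entry_le_infnorm_svec:
  assumes "A \<in> sym_mats"
  shows "A $ i $ j \<le> infnorm (svec A) / sqrt 2 * corner_mat $ i $ j"
proof -
  have upper: "A $ i $ j \<le> infnorm (svec A) / sqrt 2 * corner_mat $ i $ j"
    if "i \<le> j" for i j
  proof -
    have "Rep_upper_idx (Abs_upper_idx (i, j)) = (i, j)"
      using that by (simp add: Abs_upper_idx_inverse)
    then have "(if i = j then A $ i $ j else sqrt 2 * A $ i $ j) \<le> infnorm (svec A)"
      using component_le_infnorm_cart[of "svec A" "Abs_upper_idx (i, j)"]
      by (simp add: svec_nth split: if_splits)
    then show ?thesis
      by (auto simp: corner_mat_nth field_simps)
  qed
  show ?thesis
  proof (cases "i \<le> j")
    case False
    have "A $ i $ j = A $ j $ i"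
      using assms unfolding sym_mats_def transpose_def
      by (metis (mono_tags, lifting) mem_Collect_eq vec_lambda_beta)
    then show ?thesis
      using upper[of j i] False by (simp add: corner_mat_nth eq_commute)
  qed (rule upper)
qed

text \<open>The factor on the right is a constant of the point \<open>x\<close>, and equality holds for multiples
  \<open>c *\<^sub>R corner_mat\<close> with \<open>c \<ge> 0\<close>: among all matrices of a given norm, a single one is worst for every
  \<open>x\<close> of the simplex.\<close>

lemma quad_form_le_infnorm_svec:
  assumes "A \<in> sym_mats" and "x \<in> std_simplex"
  shows "quad_form x A \<le> infnorm (svec A) / sqrt 2 * quad_form x corner_mat"
proof -
  have "quad_form x A \<le> quad_form x ((infnorm (svec A) / sqrt 2) *\<^sub>R corner_mat)"
    using assms sym_entry_le_infnorm_svec[OF assms(1)]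
    by (intro quad_form_mono) (auto simp: std_simplex_def)
  then show ?thesis by (simp only: quad_form_scaleR)
qed

lemma sym_mats_add: "A \<in> sym_mats \<Longrightarrow> B \<in> sym_mats \<Longrightarrow> A + B \<in> sym_mats"
  by (simp add: sym_mats_def transpose_def vec_eq_iff)

lemma sym_mats_diff: "A \<in> sym_mats \<Longrightarrow> B \<in> sym_mats \<Longrightarrow> A - B \<in> sym_mats"
  by (simp add: sym_mats_def transpose_def vec_eq_iff)

lemma quad_form_le_add_infnorm_svec:
  assumes "A \<in> sym_mats" "B \<in> sym_mats" and "x \<in> std_simplex"
  shows "quad_form x A
    \<le> quad_form x B + quad_form x corner_mat / sqrt 2 * infnorm (svec A - svec B)"
  using quad_form_le_infnorm_svec[OF sym_mats_diff[OF assms(1,2)] assms(3)]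
  by (simp add: linear_diff[OF linear_quad_form] linear_diff[OF linear_svec] algebra_simps)

section \<open>Measurability and the empirical measure\<close>

lemma space_sym_borel: "space (sym_borel :: (real^'n^'n) measure) = sym_mats"
  by (simp add: sym_borel_def space_restrict_space)

lemma borel_measurable_sym_borel:
  "f \<in> borel_measurable borel \<Longrightarrow> f \<in> borel_measurable sym_borel"
  unfolding sym_borel_def by (rule measurable_restrict_space1)

lemma quad_form_measurable: "quad_form x \<in> borel_measurable sym_borel"
  by (intro borel_measurable_sym_borel borel_measurable_continuous_onI
      linear_continuous_on linear_conv_bounded_linear[THEN iffD1] linear_quad_form)

lemma svec_measurable: "svec \<in> borel_measurable sym_borel"
  by (intro borel_measurable_sym_borel borel_measurable_continuous_onI
      linear_continuous_on linear_conv_bounded_linear[THEN iffD1] linear_svec)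

lemma infnorm_svec_diff_measurable:
  "(\<lambda>w. infnorm (svec (fst w) - svec (snd w)))
     \<in> borel_measurable (sym_borel \<Otimes>\<^sub>M sym_borel)"
proof -
  have "(\<lambda>w. svec (fst w) - svec (snd w)) \<in> borel_measurable (sym_borel \<Otimes>\<^sub>M sym_borel)"
    by (intro borel_measurable_diff measurable_compose[OF measurable_fst svec_measurable]
        measurable_compose[OF measurable_snd svec_measurable])
  moreover have "infnorm \<in> borel_measurable borel"
    by (intro borel_measurable_continuous_onI continuous_intros)
  ultimately show ?thesis by (rule measurable_compose)
qed

lemma shift_map_sym: "Z \<in> sym_mats \<Longrightarrow> shift_map \<theta> Z \<in> sym_mats"
  unfolding shift_map_eq
  by (rule sym_mats_add) (auto simp: sym_mats_def transpose_def vec_eq_iff corner_mat_nth)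

lemma shift_map_measurable: "shift_map \<theta> \<in> measurable sym_borel sym_borel"
proof -
  have "shift_map \<theta> \<in> borel_measurable sym_borel"
    unfolding shift_map_def
    by (intro borel_measurable_sym_borel borel_measurable_continuous_onI continuous_intros)
  then show ?thesis
    unfolding sym_borel_def
    by (intro measurable_restrict_space2)
      (auto simp: space_restrict_space shift_map_sym)
qed

lemma sets_empirical_measure: "sets (empirical_measure N Q) = sets sym_borel"
  by (simp add: empirical_measure_def sets.sigma_sets_eq sets.space_closed)

text \<open>As the image of a uniform measure on the index set, the empirical measure inherits
  finiteness, integrals and integrability from a finite sum.\<close>

lemma empirical_measure_eq_distr:
  assumes "N \<ge> 1" and "Q ` {1..N} \<subseteq> sym_mats"
  shows "empirical_measure N Q = distr (uniform_count_measure {1..N}) sym_borel Q"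
    and "Q \<in> measurable (uniform_count_measure {1..N}) sym_borel"
proof -
  show meas: "Q \<in> measurable (uniform_count_measure {1..N}) sym_borel"
    using assms(2)
    by (auto simp: measurable_def space_uniform_count_measure sets_uniform_count_measure
        space_sym_borel)
  show "empirical_measure N Q = distr (uniform_count_measure {1..N}) sym_borel Q"
  proof (rule measure_eqI)
    fix A assume "A \<in> sets (empirical_measure N Q)"
    then have A: "A \<in> sets sym_borel" by (simp add: sets_empirical_measure)
    have "(\<Sum>i=1..N. indicator A (Q i) :: ennreal) = of_nat (card {i\<in>{1..N}. Q i \<in> A})"
      by (simp add: indicator_def sum.If_cases Int_def)
    then have "emeasure (empirical_measure N Q) A
        = ennreal (1 / real N) * of_nat (card {i\<in>{1..N}. Q i \<in> A})"
      by (simp add: emeasure_empirical_measure[OF A])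
    also have "\<dots> = ennreal (card {i\<in>{1..N}. Q i \<in> A} / real N)"
      by (simp add: ennreal_of_nat_eq_real_of_nat ennreal_mult[symmetric])
    also have "\<dots> = emeasure (uniform_count_measure {1..N}) {i\<in>{1..N}. Q i \<in> A}"
      by (subst emeasure_uniform_count_measure) auto
    also have "{i\<in>{1..N}. Q i \<in> A} = Q -` A \<inter> space (uniform_count_measure {1..N})"
      by (auto simp: space_uniform_count_measure)
    also have "emeasure (uniform_count_measure {1..N}) \<dots>
        = emeasure (distr (uniform_count_measure {1..N}) sym_borel Q) A"
      by (rule emeasure_distr[OF meas A, symmetric])
    finally show "emeasure (empirical_measure N Q) A
        = emeasure (distr (uniform_count_measure {1..N}) sym_borel Q) A" .
  qed (simp add: sets_empirical_measure)
qed

lemma empirical_measure_sym_prob: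
  assumes "N \<ge> 1" and "Q ` {1..N} \<subseteq> sym_mats"
  shows "empirical_measure N Q \<in> sym_prob_measures"
proof -
  have "prob_space (empirical_measure N Q)"
    unfolding empirical_measure_eq_distr(1)[OF assms]
    by (intro prob_space.prob_space_distr prob_space_uniform_count_measure
        empirical_measure_eq_distr(2)[OF assms]) (use assms(1) in auto)
  then show ?thesis by (simp add: sym_prob_measures_def sets_empirical_measure)
qed

lemma integrable_empirical_measure:
  fixes f :: "real^'n^'n \<Rightarrow> real"
  assumes "N \<ge> 1" and "Q ` {1..N} \<subseteq> sym_mats"
    and f: "f \<in> borel_measurable sym_borel"
  shows "integrable (empirical_measure N Q) f"
proof -
  have "integrable (uniform_count_measure {1..N}) (\<lambda>i. f (Q i))"
    unfolding uniform_count_measure_def by (rule integrable_point_measure_finite) simp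
  then show ?thesis
    unfolding empirical_measure_eq_distr(1)[OF assms(1,2)]
    by (subst integrable_distr_eq[OF empirical_measure_eq_distr(2)[OF assms(1,2)] f])
qed

lemma integral_empirical_measure:
  fixes f :: "real^'n^'n \<Rightarrow> real"
  assumes "N \<ge> 1" and "Q ` {1..N} \<subseteq> sym_mats"
    and f: "f \<in> borel_measurable sym_borel"
  shows "(\<integral>Z. f Z \<partial>empirical_measure N Q) = (\<Sum>i=1..N. f (Q i)) / N"
  unfolding empirical_measure_eq_distr(1)[OF assms(1,2)]
    integral_distr[OF empirical_measure_eq_distr(2)[OF assms(1,2)] f]
  by (simp add: integral_uniform_count_measure)

lemma expected_qf_empirical:
  assumes "N \<ge> 1" and "Q ` {1..N} \<subseteq> sym_mats"
  shows "expected_qf (empirical_measure N Q) x = quad_form x (sample_mean N Q)"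
  unfolding expected_qf_def sample_mean_def quad_form_scaleR
    linear_sum[OF linear_quad_form]
    integral_empirical_measure[OF assms quad_form_measurable]
  by simp

section \<open>The upper bound on the ball\<close>

text \<open>The convex function \<open>y \<mapsto> y\<^sup>p\<close> lies above its tangent at \<open>t\<close>. Solved for \<open>y\<close>, this is weighted
  AM-GM applied to \<open>(y / t)\<^sup>p\<close> and \<open>1\<close>.\<close>

lemma le_powr_tangent:
  fixes y t p :: real
  assumes "0 \<le> y" "0 < t" "1 \<le> p"
  shows "y \<le> t / p * (y powr p / t powr p) + t * (1 - 1 / p)"
proof (cases "y = 0")
  case True
  then show ?thesis using assms by simp
next
  case False
  have "((y / t) powr p) powr (1 / p) * 1 powr (1 - 1 / p)
      \<le> 1 / p * (y / t) powr p + (1 - 1 / p) * 1"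
    using assms False by (intro Youngs_inequality_0) auto
  then have "y / t \<le> 1 / p * (y / t) powr p + (1 - 1 / p)"
    using assms by (simp add: powr_powr)
  then have "t * (y / t) \<le> t * (1 / p * (y / t) powr p + (1 - 1 / p))"
    using assms by (intro mult_left_mono) auto
  then show ?thesis using assms by (simp add: powr_divide algebra_simps)
qed

text \<open>Integrating the tangent inequality, with the tangent taken at the bound \<open>t\<close> of the power mean,
  gives integrability and the estimate at once; the right-hand side then collapses to \<open>t\<close>.\<close>

lemma (in prob_space) expectation_le_power_mean:
  assumes [measurable]: "f \<in> borel_measurable M" and nonneg: "\<And>w. 0 \<le> f w"
    and "0 < t" "1 \<le> p"
    and bound: "(\<integral>\<^sup>+w. ennreal (f w powr p) \<partial>M) \<le> ennreal (t powr p)"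
  shows "integrable M f" and "(\<integral>w. f w \<partial>M) \<le> t"
proof -
  let ?g = "\<lambda>w. t / p * (f w powr p / t powr p) + t * (1 - 1 / p)"
  have le: "f w \<le> ?g w" for w
    using le_powr_tangent[of "f w" t p] nonneg assms by auto
  have int_p: "integrable M (\<lambda>w. f w powr p)"
    using bound by (intro integrableI_bounded) (auto simp: le_less_trans)
  then have int_g: "integrable M ?g" by simp
  show int: "integrable M f"
  proof (rule Bochner_Integration.integrable_bound[OF int_g])
    show "AE w in M. norm (f w) \<le> norm (?g w)"
      using order_trans[OF le abs_ge_self] nonneg by (intro AE_I2) simp
  qed simp
  have "(\<integral>w. f w powr p \<partial>M) \<le> t powr p"
    using bound nn_integral_eq_integral[OF int_p] by simp
  then have "t / p * ((\<integral>w. f w powr p \<partial>M) / t powr p) \<le> t / p * 1"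
    using assms by (intro mult_left_mono) (auto simp: field_simps)
  moreover have "(\<integral>w. f w \<partial>M) \<le> (\<integral>w. ?g w \<partial>M)"
    by (rule integral_mono[OF int int_g le])
  moreover have "(\<integral>w. ?g w \<partial>M) = t / p * ((\<integral>w. f w powr p \<partial>M) / t powr p) + t * (1 - 1 / p)"
    using int_p by (simp add: prob_space)
  ultimately show "(\<integral>w. f w \<partial>M) \<le> t"
    by (simp add: algebra_simps)
qed

lemma expected_qf_coupling_le:
  fixes x :: "real^'n::{finite,linorder}"
  assumes P: "P \<in> sym_prob_measures" and P': "P' \<in> sym_prob_measures"
    and int: "integrable P' (quad_form x)" and x: "x \<in> std_simplex"
    and \<pi>: "\<pi> \<in> couplings P P'" and "0 < t" "1 \<le> p"
    and cost: "(\<integral>\<^sup>+(A, B). ennreal (infnorm (svec A - svec B) powr p) \<partial>\<pi>) \<le> ennreal (t powr p)"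
  shows "expected_qf P x \<le> expected_qf P' x + t / sqrt 2 * quad_form x corner_mat"
proof -
  let ?D = "\<lambda>w :: 'n sq_matrix \<times> 'n sq_matrix. infnorm (svec (fst w) - svec (snd w))"
  let ?K = "quad_form x corner_mat / sqrt 2"
  have sets_P [measurable_cong]: "sets P = sets sym_borel" "sets P' = sets sym_borel"
    using P P' by (auto simp: sym_prob_measures_def)
  interpret \<pi>: prob_space \<pi> using \<pi> by (simp add: couplings_def)
  have sets_\<pi>: "sets \<pi> = sets (sym_borel \<Otimes>\<^sub>M sym_borel)"
    using \<pi> by (simp add: couplings_def sets_P cong: sets_pair_measure_cong)
  have fst: "fst \<in> measurable \<pi> P" and snd: "snd \<in> measurable \<pi> P'"
    unfolding measurable_cong_sets[OF sets_\<pi> sets_P(1)] measurable_cong_sets[OF sets_\<pi> sets_P(2)]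
    by (rule measurable_fst, rule measurable_snd)
  have marg: "distr \<pi> P fst = P" "distr \<pi> P' snd = P'"
    using \<pi> by (auto simp: couplings_def)
  have qf: "quad_form x \<in> borel_measurable P" "quad_form x \<in> borel_measurable P'"
    using quad_form_measurable[of x] by (simp_all add: measurable_cong_sets[OF sets_P(1) refl]
        measurable_cong_sets[OF sets_P(2) refl])
  have D: "?D \<in> borel_measurable \<pi>"
    using infnorm_svec_diff_measurable by (simp add: measurable_cong_sets[OF sets_\<pi> refl])
  note D_int = \<pi>.expectation_le_power_mean[OF D infnorm_pos_le \<open>0 < t\<close> \<open>1 \<le> p\<close>
      cost[unfolded case_prod_beta]]
  have E: "expected_qf P x = (\<integral>w. quad_form x (fst w) \<partial>\<pi>)"
    unfolding expected_qf_def using integral_distr[OF fst qf(1)] by (simp add: marg)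
  have E': "expected_qf P' x = (\<integral>w. quad_form x (snd w) \<partial>\<pi>)"
    unfolding expected_qf_def using integral_distr[OF snd qf(2)] by (simp add: marg)
  have int_snd: "integrable \<pi> (\<lambda>w. quad_form x (snd w))"
    using integrable_distr_eq[OF snd qf(2)] int by (simp add: marg)
  have K: "0 \<le> ?K"
    using quad_form_corner_mat_pos[OF x] by simp
  have space_\<pi>: "space \<pi> = sym_mats \<times> sym_mats"
    using sets_eq_imp_space_eq[OF sets_\<pi>] by (simp add: space_pair_measure space_sym_borel)
  have le: "quad_form x (fst w) \<le> quad_form x (snd w) + ?K * ?D w" if "w \<in> space \<pi>" for w
    using that by (intro quad_form_le_add_infnorm_svec x) (auto simp: space_\<pi>)
  have int_rhs: "integrable \<pi> (\<lambda>w. quad_form x (snd w) + ?K * ?D w)"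
    using int_snd D_int(1) by simp
  \<comment> \<open>Integrability under \<open>P\<close> must be derived, since a non-integrable function has integral 0 by
    convention. It needs a bound from below too, which is \<open>le\<close> with the components exchanged.\<close>
  have ge: "quad_form x (snd w) \<le> quad_form x (fst w) + ?K * ?D w" if "w \<in> space \<pi>" for w
    unfolding infnorm_sub[of "svec (fst w)"]
    using that by (intro quad_form_le_add_infnorm_svec x) (auto simp: space_\<pi>)
  have int_fst: "integrable \<pi> (\<lambda>w. quad_form x (fst w))"
  proof (rule Bochner_Integration.integrable_bound)
    show "integrable \<pi> (\<lambda>w. \<bar>quad_form x (snd w)\<bar> + ?K * ?D w)"
      using int_snd D_int(1) by simp
    show "(\<lambda>w. quad_form x (fst w)) \<in> borel_measurable \<pi>"
      by (rule measurable_compose[OF fst qf(1)])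
    show "AE w in \<pi>. norm (quad_form x (fst w)) \<le> norm (\<bar>quad_form x (snd w)\<bar> + ?K * ?D w)"
    proof (rule AE_I2)
      fix w assume w: "w \<in> space \<pi>"
      have "0 \<le> ?K * ?D w" using K infnorm_pos_le by (rule mult_nonneg_nonneg)
      then show "norm (quad_form x (fst w)) \<le> norm (\<bar>quad_form x (snd w)\<bar> + ?K * ?D w)"
        using le[OF w] ge[OF w] unfolding real_norm_def by linarith
    qed
  qed
  have "expected_qf P x \<le> (\<integral>w. quad_form x (snd w) + ?K * ?D w \<partial>\<pi>)"
    unfolding E by (rule integral_mono[OF int_fst int_rhs le])
  also have "\<dots> = expected_qf P' x + ?K * (\<integral>w. ?D w \<partial>\<pi>)"
    unfolding E' using int_snd D_int(1) by simp
  also have "\<dots> \<le> expected_qf P' x + ?K * t"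
    by (intro add_left_mono mult_left_mono D_int(2) K)
  finally show ?thesis by (simp add: mult.commute)
qed

text \<open>The definition of the distance as an infimum only supplies couplings of cost below \<open>t\<^sup>p\<close> for
  each \<open>t > \<theta>\<close>. This suffices, since the bound from a coupling is continuous in \<open>t\<close>.\<close>

lemma expected_qf_ball_le:
  fixes x :: "real^'n::{finite,linorder}"
  assumes P: "P \<in> wasserstein_ball \<theta> p P'" and P': "P' \<in> sym_prob_measures"
    and int: "integrable P' (quad_form x)" and x: "x \<in> std_simplex"
    and "0 < \<theta>" "1 \<le> p"
  shows "expected_qf P x \<le> expected_qf P' x + \<theta> / sqrt 2 * quad_form x corner_mat"
proof -
  let ?K = "quad_form x corner_mat / sqrt 2"
  let ?C = "transport_cost p P P'"
  have K: "0 < ?K" using quad_form_corner_mat_pos[OF x] by simp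
  have P_prob: "P \<in> sym_prob_measures" and W: "wasserstein p P P' \<le> ennreal \<theta>"
    using P by (auto simp: wasserstein_ball_def)
  have fin: "?C \<noteq> \<infinity>"
    using W by (auto simp: wasserstein_def top_unique split: if_splits)
  then have root: "enn2real ?C powr (1 / p) \<le> \<theta>"
    using W \<open>0 < \<theta>\<close> by (simp add: wasserstein_def)
  have "(expected_qf P x - expected_qf P' x) / ?K \<le> t" if "\<theta> < t" for t
  proof -
    have "enn2real ?C = (enn2real ?C powr (1 / p)) powr p"
      using \<open>1 \<le> p\<close> by (simp add: powr_powr)
    also have "\<dots> \<le> \<theta> powr p"
      using root \<open>1 \<le> p\<close> by (intro powr_mono2) auto
    also have "\<dots> < t powr p"
      using that \<open>0 < \<theta>\<close> \<open>1 \<le> p\<close> by (intro powr_less_mono2) auto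
    finally have "ennreal (enn2real ?C) < ennreal (t powr p)"
      using that \<open>0 < \<theta>\<close> by (intro ennreal_lessI) auto
    then have "?C < ennreal (t powr p)"
      using fin by (simp add: less_top)
    then obtain \<pi> where "\<pi> \<in> couplings P P'" and
      "(\<integral>\<^sup>+(A, B). ennreal (infnorm (svec A - svec B) powr p) \<partial>\<pi>) < ennreal (t powr p)"
      unfolding transport_cost_def by (auto simp: INF_less_iff)
    then have "expected_qf P x \<le> expected_qf P' x + t / sqrt 2 * quad_form x corner_mat"
      using that \<open>0 < \<theta>\<close> \<open>1 \<le> p\<close>
      by (intro expected_qf_coupling_le[OF P_prob P' int x]) auto
    then show ?thesis
      using quad_form_corner_mat_pos[OF x] by (simp add: field_simps)
  qed
  then have "(expected_qf P x - expected_qf P' x) / ?K \<le> \<theta>" by (rule dense_ge)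
  then show ?thesis
    using quad_form_corner_mat_pos[OF x] by (simp add: field_simps)
qed

section \<open>The worst-case measure\<close>

lemma expected_qf_worst_case:
  assumes P: "P \<in> sym_prob_measures" and int: "integrable P (quad_form x)"
  shows "expected_qf (worst_case_measure \<theta> P) x
    = expected_qf P x + \<theta> / sqrt 2 * quad_form x corner_mat"
proof -
  have s: "sets P = sets sym_borel" and "prob_space P"
    using P by (auto simp: sym_prob_measures_def)
  then interpret prob_space P by simp
  have "shift_map \<theta> \<in> measurable P sym_borel"
    using shift_map_measurable by (simp add: measurable_cong_sets[OF s refl])
  then have "expected_qf (worst_case_measure \<theta> P) x = (\<integral>Z. quad_form x (shift_map \<theta> Z) \<partial>P)"
    unfolding expected_qf_def worst_case_measure_def
    by (rule integral_distr) (rule quad_form_measurable)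
  also have "\<dots> = expected_qf P x + \<theta> / sqrt 2 * quad_form x corner_mat"
    using int by (simp add: shift_map_eq quad_form_add quad_form_scaleR expected_qf_def prob_space)
  finally show ?thesis .
qed

text \<open>Coupling each point with its own translate gives the distance the constant value \<open>\<theta>\<close>,
  whose \<open>p\<close>-th power mean is \<open>\<theta>\<close> for every \<open>p\<close>.\<close>

lemma worst_case_measure_in_ball:
  fixes P :: "'n::{finite,linorder} sq_matrix measure"
  assumes P: "P \<in> sym_prob_measures" and "0 < \<theta>" "1 \<le> p"
  shows "worst_case_measure \<theta> P \<in> wasserstein_ball \<theta> p P"
proof -
  let ?W = "worst_case_measure \<theta> P"
  let ?T = "\<lambda>Z. (shift_map \<theta> Z, Z)"
  have s: "sets P = sets sym_borel" and "prob_space P"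
    using P by (auto simp: sym_prob_measures_def)
  then interpret prob_space P by simp
  have sW: "sets ?W = sets sym_borel" by (simp add: worst_case_measure_def)
  have shift: "shift_map \<theta> \<in> measurable P sym_borel"
    using shift_map_measurable by (simp add: measurable_cong_sets[OF s refl])
  have shiftW: "shift_map \<theta> \<in> measurable P ?W"
    using shift by (simp add: measurable_cong_sets[OF refl sW])
  have T: "?T \<in> measurable P (?W \<Otimes>\<^sub>M P)"
    using shiftW by (rule measurable_Pair) simp
  have W: "?W \<in> sym_prob_measures"
    using prob_space_distr[OF shift] by (simp add: sym_prob_measures_def worst_case_measure_def)
  define \<pi> where "\<pi> = distr P (?W \<Otimes>\<^sub>M P) ?T"
  have "distr \<pi> ?W fst = distr P ?W (shift_map \<theta>)"
    unfolding \<pi>_def by (subst distr_distr[OF measurable_fst T]) (simp add: comp_def)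
  also have "\<dots> = ?W"
    unfolding worst_case_measure_def by (rule distr_cong) simp_all
  finally have 1: "distr \<pi> ?W fst = ?W" .
  have 2: "distr \<pi> P snd = P"
    unfolding \<pi>_def by (subst distr_distr[OF measurable_snd T]) (simp add: comp_def distr_id2)
  have coupling: "\<pi> \<in> couplings ?W P"
    using 1 2 prob_space_distr[OF T] by (simp add: couplings_def \<pi>_def)
  have dist: "infnorm (svec (shift_map \<theta> Z) - svec Z) = \<theta>" for Z :: "'n sq_matrix"
    using \<open>0 < \<theta>\<close>
    by (simp add: shift_map_eq svec_add svec_scaleR infnorm_mul infnorm_svec_corner_mat)
  have meas: "(\<lambda>w. ennreal (infnorm (svec (fst w) - svec (snd w)) powr p))
      \<in> borel_measurable (?W \<Otimes>\<^sub>M P)"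
  proof -
    have "sets (?W \<Otimes>\<^sub>M P) = sets (sym_borel \<Otimes>\<^sub>M sym_borel)"
      by (rule sets_pair_measure_cong[OF sW s])
    then have "(\<lambda>w. infnorm (svec (fst w) - svec (snd w))) \<in> borel_measurable (?W \<Otimes>\<^sub>M P)"
      using infnorm_svec_diff_measurable by (simp cong: measurable_cong_sets)
    then show ?thesis by measurable
  qed
  have "transport_cost p ?W P \<le> (\<integral>\<^sup>+(A, B). ennreal (infnorm (svec A - svec B) powr p) \<partial>\<pi>)"
    unfolding transport_cost_def by (rule INF_lower[OF coupling])
  also have "\<dots> = ennreal (\<theta> powr p)"
    unfolding \<pi>_def case_prod_beta using meas
    by (simp add: nn_integral_distr[OF T] dist emeasure_space_1)
  finally have cost: "transport_cost p ?W P \<le> ennreal (\<theta> powr p)" .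
  then have "enn2real (transport_cost p ?W P) \<le> \<theta> powr p"
    by (intro enn2real_leI) auto
  then have "enn2real (transport_cost p ?W P) powr (1 / p) \<le> (\<theta> powr p) powr (1 / p)"
    using \<open>1 \<le> p\<close> by (intro powr_mono2) auto
  then have "enn2real (transport_cost p ?W P) powr (1 / p) \<le> \<theta>"
    using \<open>1 \<le> p\<close> \<open>0 < \<theta>\<close> by (simp add: powr_powr)
  moreover have "transport_cost p ?W P \<noteq> \<infinity>"
    using cost by (auto simp: top_unique)
  ultimately show ?thesis
    using W by (simp add: wasserstein_ball_def wasserstein_def ennreal_leI)
qed

section \<open>Minimax equality\<close>

lemma INF_SUP_eq_of_uniform_maximizer:
  fixes f :: "'a \<Rightarrow> 'b \<Rightarrow> 'c::complete_lattice"
  assumes "w \<in> B" and "\<And>x b. x \<in> X \<Longrightarrow> b \<in> B \<Longrightarrow> f b x \<le> f w x"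
  shows "(INF x\<in>X. SUP b\<in>B. f b x) = (INF x\<in>X. f w x)"
    and "(SUP b\<in>B. INF x\<in>X. f b x) = (INF x\<in>X. f w x)"
    and "x \<in> X \<Longrightarrow> (SUP b\<in>B. f b x) = f w x"
proof -
  show sup: "(SUP b\<in>B. f b x) = f w x" if "x \<in> X" for x
    using assms that by (intro antisym SUP_least SUP_upper) auto
  show "(INF x\<in>X. SUP b\<in>B. f b x) = (INF x\<in>X. f w x)"
    by (rule INF_cong) (auto simp: sup)
  show "(SUP b\<in>B. INF x\<in>X. f b x) = (INF x\<in>X. f w x)"
  proof (rule antisym)
    show "(SUP b\<in>B. INF x\<in>X. f b x) \<le> (INF x\<in>X. f w x)"
      by (intro SUP_least INF_mono) (use assms(2) in blast)
    show "(INF x\<in>X. f w x) \<le> (SUP b\<in>B. INF x\<in>X. f b x)"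
      by (rule SUP_upper[OF assms(1)])
  qed
qed

theorem theoremA3:
  fixes N :: nat and p \<theta> :: real
    and Q :: "nat \<Rightarrow> 'n::{finite,linorder} sq_matrix"
  assumes "N \<ge> 1" and "p \<ge> 1" and "\<theta> > 0"
    and "\<And>i. i \<in> {1..N} \<Longrightarrow> Q i \<in> sym_mats"
  shows "(\<exists>x\<^sub>0. is_arg_min
             (\<lambda>x. quad_form x (sample_mean N Q + (\<theta> * (sqrt 2 - 1) / sqrt 2) *\<^sub>R mat 1))
             (\<lambda>x. x \<in> std_simplex) x\<^sub>0 \<and>
           (INF x\<in>std_simplex. SUP P\<in>wasserstein_ball \<theta> p (empirical_measure N Q).
              ereal (expected_qf P x)) =
           ereal (\<theta> / sqrt 2 +
              quad_form x\<^sub>0 (sample_mean N Q + (\<theta> * (sqrt 2 - 1) / sqrt 2) *\<^sub>R mat 1)))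
    \<and> worst_case_measure \<theta> (empirical_measure N Q)
         \<in> wasserstein_ball \<theta> p (empirical_measure N Q)
    \<and> (\<forall>x\<in>std_simplex.
         ereal (expected_qf (worst_case_measure \<theta> (empirical_measure N Q)) x) =
         (SUP P\<in>wasserstein_ball \<theta> p (empirical_measure N Q). ereal (expected_qf P x)))
    \<and> (INF x\<in>std_simplex. SUP P\<in>wasserstein_ball \<theta> p (empirical_measure N Q).
         ereal (expected_qf P x)) =
      (SUP P\<in>wasserstein_ball \<theta> p (empirical_measure N Q). INF x\<in>std_simplex.
         ereal (expected_qf P x))"
proof -
  let ?E = "empirical_measure N Q"
  let ?W = "worst_case_measure \<theta> ?E"
  let ?B = "wasserstein_ball \<theta> p ?E"
  let ?q = "\<lambda>x. quad_form x (sample_mean N Q + (\<theta> * (sqrt 2 - 1) / sqrt 2) *\<^sub>R mat 1)"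
  have Q: "Q ` {1..N} \<subseteq> sym_mats"
    using assms(4) by blast
  have E: "?E \<in> sym_prob_measures"
    by (rule empirical_measure_sym_prob[OF assms(1) Q])
  have int: "integrable ?E (quad_form x)" for x
    by (rule integrable_empirical_measure[OF assms(1) Q quad_form_measurable])
  have W: "?W \<in> ?B"
    using assms by (intro worst_case_measure_in_ball[OF E]) auto
  have max: "ereal (expected_qf P x) \<le> ereal (expected_qf ?W x)"
    if "x \<in> std_simplex" "P \<in> ?B" for x P
    using expected_qf_ball_le[OF that(2) E int that(1)] assms
    by (simp add: expected_qf_worst_case[OF E int])
  note minimax = INF_SUP_eq_of_uniform_maximizer[where B = ?B and X = std_simplex
      and f = "\<lambda>P x. ereal (expected_qf P x)", OF W max]
  have worst_value: "expected_qf ?W x = \<theta> / sqrt 2 + ?q x" if "x \<in> std_simplex" for x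
    using that expected_qf_empirical[OF assms(1) Q]
    by (simp add: expected_qf_worst_case[OF E int] quad_form_corner_mat quad_form_add
        quad_form_scaleR field_simps)
  obtain x\<^sub>0 where x\<^sub>0: "x\<^sub>0 \<in> std_simplex" "\<And>x. x \<in> std_simplex \<Longrightarrow> ?q x\<^sub>0 \<le> ?q x"
    using continuous_attains_inf[OF compact_std_simplex std_simplex_nonempty
        continuous_on_quad_form] by metis
  have "(INF x\<in>std_simplex. ereal (expected_qf ?W x)) = ereal (expected_qf ?W x\<^sub>0)"
    using x\<^sub>0 by (intro antisym INF_lower INF_greatest) (auto simp: worst_value)
  then have "(INF x\<in>std_simplex. SUP P\<in>?B. ereal (expected_qf P x)) = ereal (\<theta> / sqrt 2 + ?q x\<^sub>0)"
    using minimax(1) worst_value[OF x\<^sub>0(1)] by simp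
  moreover have "is_arg_min ?q (\<lambda>x. x \<in> std_simplex) x\<^sub>0"
    using x\<^sub>0 by (auto simp: is_arg_min_linorder)
  ultimately show ?thesis
    using W minimax by auto
qed

end
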